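(* Let $r>2$ and $\delta_0$ be integers. Suppose that at least one of the following holds: (i) there is a constant $C$ such that $\chi'_{a,r}(G)\leq \Delta(G)+C$ for every graph $G$ with $\delta(G)\geq \delta_0$ and without isolated edges; or (ii) $\chi'_{a,r}(G)\leq (1+o(1))\Delta(G)$ for every graph $G$ with $\delta(G)\geq \delta_0$ and without isolated edges, where $o(1)$ tends to $0$ as $\Delta(G)\to\infty$; that is, for every real $\eta>0$ there is $\Delta_0$ such that $\chi'_{a,r}(G)\leq(1+\eta)\Delta(G)$ for every graph $G$ without isolated edges with $\delta(G)\geq\delta_0$ and $\Delta(G)\geq\Delta_0$. Then $\delta_0\geq r$ if $r\geq 7$, and $\delta_0\geq r-1$ if $3\leq r\leq 6$.
   Context: All graphs are finite and simple. An isolated edge of $G$ is a connected component of $G$ isomorphic to $K_2$. $\delta(G)$ and $\Delta(G)$ denote the minimum and maximum degree of $G$, and $d(u,v)$ denotes the distance between vertices $u,v$ in $G$ (infinite if they lie in different components). For a proper edge colouring $c:E(G)\to\{1,2,\ldots,k\}$ (edges sharing an end receive distinct colours) and a vertex $v$, let $S_c(v)=\{c(uv):u\in N(v)\}$ be the set of colours on edges incident with $v$, where $N(v)$ is the set of neighbours of $v$. For a positive integer $r$ and a graph $G$ without isolated edges, $\chi'_{a,r}(G)$ (the $r$-adjacent strong chromatic index) is the least $k$ for which there is a proper edge colouring $c:E(G)\to\{1,\ldots,k\}$ such that $S_c(u)\neq S_c(v)$ for every pair of vertices $u,v$ with $1\leq d(u,v)\leq r$. *)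

theory Defs
  imports Complex_Main "HOL-Library.Extended_Nat"
begin

record 'v ugraph =
  verts :: "'v set"
  edges :: "'v set set"

text \<open>The null graph is excluded, so that minimum and maximum degree are meaningful.\<close>

definition simple_graph :: "'v ugraph \<Rightarrow> bool" where
  "simple_graph G \<longleftrightarrow>
     finite (verts G) \<and> verts G \<noteq> {} \<and>
     (\<forall>e\<in>edges G. e \<subseteq> verts G \<and> card e = 2)"

definition nbrs :: "'v ugraph \<Rightarrow> 'v \<Rightarrow> 'v set" where
  "nbrs G v = {u. {u, v} \<in> edges G}"

definition degree :: "'v ugraph \<Rightarrow> 'v \<Rightarrow> nat" where
  "degree G v = card (nbrs G v)"

definition min_degree :: "'v ugraph \<Rightarrow> nat" where
  "min_degree G = Min (degree G ` verts G)"

definition max_degree :: "'v ugraph \<Rightarrow> nat" where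
  "max_degree G = Max (degree G ` verts G)"

text \<open>The relational power \<open>R ^^ n\<close> of the adjacency relation relates the ends of walks of
  length \<open>n\<close>. The infimum of the empty set in \<^typ>\<open>enat\<close> is \<open>\<infinity>\<close>.\<close>

definition adj_rel :: "'v ugraph \<Rightarrow> ('v \<times> 'v) set" where
  "adj_rel G = {(u, v). {u, v} \<in> edges G}"

definition gdist :: "'v ugraph \<Rightarrow> 'v \<Rightarrow> 'v \<Rightarrow> enat" where
  "gdist G u v = Inf (enat ` {n. (u, v) \<in> adj_rel G ^^ n})"

definition components :: "'v ugraph \<Rightarrow> 'v set set" where
  "components G = {{w \<in> verts G. gdist G v w \<noteq> \<infinity>} | v. v \<in> verts G}"

text \<open>A component is isomorphic to \<open>K\<^sub>2\<close> iff its vertex set is \<open>{u, v}\<close> for an edge \<open>uv\<close>.\<close>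

definition isolated_edge :: "'v ugraph \<Rightarrow> 'v set \<Rightarrow> bool" where
  "isolated_edge G e \<longleftrightarrow> e \<in> edges G \<and> e \<in> components G"

definition proper_edge_colouring :: "'v ugraph \<Rightarrow> nat \<Rightarrow> ('v set \<Rightarrow> nat) \<Rightarrow> bool" where
  "proper_edge_colouring G k c \<longleftrightarrow>
     (\<forall>e\<in>edges G. c e \<in> {1..k}) \<and>
     (\<forall>e\<in>edges G. \<forall>f\<in>edges G. e \<noteq> f \<and> e \<inter> f \<noteq> {} \<longrightarrow> c e \<noteq> c f)"

definition colour_set :: "'v ugraph \<Rightarrow> ('v set \<Rightarrow> nat) \<Rightarrow> 'v \<Rightarrow> nat set" where
  "colour_set G c v = (\<lambda>u. c {u, v}) ` nbrs G v"

text \<open>If a graph has no isolated edge, giving all edges distinct colours shows that some \<open>k\<close>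
  is admissible; otherwise the \<open>LEAST\<close> is unspecified.\<close>

definition adj_strong_chromatic_index :: "nat \<Rightarrow> 'v ugraph \<Rightarrow> nat" where
  "adj_strong_chromatic_index r G =
     (LEAST k. \<exists>c. proper_edge_colouring G k c \<and>
        (\<forall>u\<in>verts G. \<forall>v\<in>verts G.
           1 \<le> gdist G u v \<and> gdist G u v \<le> enat r \<longrightarrow> colour_set G c u \<noteq> colour_set G c v))"

text \<open>Every finite graph is isomorphic to one whose vertices are natural numbers, so ranging over
  \<^typ>\<open>nat ugraph\<close> amounts to ranging over all finite graphs.\<close>

definition admissible_graph :: "int \<Rightarrow> nat ugraph \<Rightarrow> bool" where
  "admissible_graph d G \<longleftrightarrow>
     simple_graph G \<and> (\<nexists>e. isolated_edge G e) \<and> d \<le> int (min_degree G)"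

end

theory Submission
  imports Defs "HOL-Library.Countable"
begin

text \<open>
  Put \<open>n = r - 2\<close>. The idea is to build graphs of diameter at most \<open>r\<close> in which very many vertices
  have the same small degree \<open>q\<close>. Their colour sets are then pairwise distinct \<open>q\<close>-subsets of the
  \<open>k\<close> colours, so their number is at most \<open>k choose q \<le> k ^ q / q!\<close> (lemma \<open>card_le_choose\<close>).

  The graphs are undirected de Bruijn graphs: the hubs are the words of length \<open>n\<close> over an alphabet
  of size \<open>m\<close>, and a word is adjacent to its shifts in both directions. There are \<open>m ^ n\<close> hubs, of
  degree at most \<open>2 m\<close> and at mutual distance at most \<open>n\<close>. To each hub are attached \<open>h\<close> disjoint
  copies of the complete graph on \<open>q\<close> vertices, every vertex of which is joined to the hub. These
  \<open>h q m ^ n\<close> new vertices, the leaves, have degree \<open>q\<close>, and the diameter grows by at most \<open>2\<close>, to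
  \<open>n + 2 = r\<close> (lemma \<open>db_graph_properties\<close>).

  With \<open>m = n s\<close> and \<open>h q = 2 s\<close> the maximum degree is at most \<open>\<Delta> = 2 s (n + 1)\<close>, while there are
  \<open>2 n ^ n s ^ (n + 1)\<close> leaves; this ratio of \<open>m\<close> to \<open>h q\<close> maximises the number \<open>m ^ n h q\<close> of
  leaves for given \<open>2 m + h q\<close>. As \<open>s\<close> tends to infinity there are two cases.
  \<^item> If \<open>q = n = r - 2\<close>, then \<open>\<Delta> ^ q\<close> is only of order \<open>s ^ n\<close>, so no number of colours linear in
    \<open>\<Delta>\<close> suffices (lemma \<open>threshold_gt\<close>).
  \<^item> If \<open>q = n + 1 = r - 1\<close>, then \<open>\<Delta> ^ q\<close> and the number of leaves both have order \<open>s ^ (n + 1)\<close> and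
    the constants decide: some \<open>\<eta> > 0\<close> makes \<open>(1 + \<eta>) \<Delta>\<close> colours too few as soon as
    \<open>2 ^ n (n + 1) ^ n < n ^ n n!\<close>. This holds for \<open>n \<ge> 5\<close> because \<open>((n + 1) / n) ^ n < 3\<close> and
    \<open>3 * 2 ^ n < n!\<close>, and fails for \<open>n = 4\<close>; that is why \<open>r \<ge> 7\<close> is separated from
    smaller \<open>r\<close> (lemma \<open>threshold_gt_Suc\<close>).

  A bound \<open>\<Delta> + C\<close> is at most \<open>(1 + \<eta>) \<Delta>\<close> once \<open>\<Delta> \<ge> C / \<eta>\<close>, so only the second hypothesis
  needs to be refuted.
\<close>

section \<open>Distances, components and colour sets\<close>

lemma adj_rel_iff_nbrs: "(u, v) \<in> adj_rel G \<longleftrightarrow> v \<in> nbrs G u"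
  by (simp add: adj_rel_def nbrs_def insert_commute)

lemma finite_edges: "simple_graph G \<Longrightarrow> finite (edges G)"
  by (rule finite_subset[of _ "Pow (verts G)"]) (auto simp: simple_graph_def)

lemma gdist_ge_1: "u \<noteq> v \<Longrightarrow> 1 \<le> gdist G u v"
  unfolding gdist_def
proof (rule Inf_greatest)
  fix x assume "u \<noteq> v" "x \<in> enat ` {n. (u, v) \<in> adj_rel G ^^ n}"
  then obtain k where k: "x = enat k" "(u, v) \<in> adj_rel G ^^ k" by auto
  then have "k \<noteq> 0" using \<open>u \<noteq> v\<close> by (intro notI) auto
  then show "1 \<le> x" using k by (simp add: one_enat_def)
qed

lemma gdist_self: "gdist G u u = 0"
proof -
  have "gdist G u u \<le> enat 0"
    unfolding gdist_def by (intro Inf_lower image_eqI[where x = 0]) auto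
  then show ?thesis by (simp add: zero_enat_def[symmetric])
qed

lemma gdist_finite_iff: "gdist G u v \<noteq> \<infinity> \<longleftrightarrow> (u, v) \<in> (adj_rel G)\<^sup>*"
proof -
  have "gdist G u v = \<infinity> \<longleftrightarrow> (\<forall>x\<in>enat ` {n. (u, v) \<in> adj_rel G ^^ n}. x = \<infinity>)"
    unfolding gdist_def using Inf_top_conv(1)[where 'a = enat] by (simp add: top_enat_def)
  then show ?thesis by (auto simp: rtrancl_power)
qed

lemma relpow_reflcl_le: "(u, v) \<in> (R\<^sup>=) ^^ i \<Longrightarrow> \<exists>k\<le>i. (u, v) \<in> R ^^ k"
proof (induction i arbitrary: v)
  case (Suc i)
  then obtain w where w: "(u, w) \<in> (R\<^sup>=) ^^ i" "(w, v) \<in> R\<^sup>=" by auto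
  from Suc.IH[OF w(1)] obtain k where k: "k \<le> i" "(u, w) \<in> R ^^ k" by auto
  show ?case
  proof (cases "w = v")
    case True
    then show ?thesis using k by (intro exI[of _ k]) auto
  next
    case False
    then show ?thesis using k w by (intro exI[of _ "Suc k"]) auto
  qed
qed auto

lemma gdist_le: "(u, v) \<in> ((adj_rel G)\<^sup>=) ^^ i \<Longrightarrow> gdist G u v \<le> enat i"
  by (drule relpow_reflcl_le, unfold gdist_def) (auto intro: Inf_lower2)

lemma no_isolated_edge:
  assumes G: "simple_graph G" and "card (verts G) > 2"
    and conn: "\<And>u v. u \<in> verts G \<Longrightarrow> v \<in> verts G \<Longrightarrow> gdist G u v \<noteq> \<infinity>"
  shows "\<not> isolated_edge G e"
proof
  assume "isolated_edge G e"
  then have "e \<in> edges G" "e \<in> components G" by (auto simp: isolated_edge_def)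
  then have "card e = 2" "e = verts G"
    using G conn by (auto simp: simple_graph_def components_def)
  with assms(2) show False by simp
qed

text \<open>If the colours determine the edges, two vertices with the same colour set are incident with the
  same edges. The only edge that two vertices can share is the one joining them, so they would
  span an isolated edge.\<close>

lemma rainbow_distinguishes:
  assumes G: "simple_graph G" and iso: "\<nexists>e. isolated_edge G e"
    and c: "inj_on c (edges G)" and "u \<in> verts G" "v \<in> verts G" and "u \<noteq> v"
    and "gdist G u v \<noteq> \<infinity>"
  shows "colour_set G c u \<noteq> colour_set G c v"
proof
  assume eq: "colour_set G c u = colour_set G c v"
  have sub: "w = y" if *: "colour_set G c x = colour_set G c y" "x \<noteq> y" "w \<in> nbrs G x" for x y w
  proof -
    have "c {w, x} \<in> colour_set G c y"
      unfolding *(1)[symmetric] unfolding colour_set_def using *(3) by (rule imageI)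
    then obtain w' where w': "w' \<in> nbrs G y" "c {w, x} = c {w', y}"
      unfolding colour_set_def by (rule imageE)
    have "{w, x} = {w', y}"
      by (rule inj_onD[OF c w'(2)]) (use *(3) w'(1) in \<open>simp_all add: nbrs_def\<close>)
    then show ?thesis using \<open>x \<noteq> y\<close> by (simp add: doubleton_eq_iff)
  qed
  have nu: "nbrs G u \<subseteq> {v}" and nv: "nbrs G v \<subseteq> {u}"
    using sub[OF eq \<open>u \<noteq> v\<close>] sub[OF eq[symmetric] \<open>u \<noteq> v\<close>[symmetric]] by auto
  have "(u, v) \<in> (adj_rel G)\<^sup>*" using assms(7) gdist_finite_iff by metis
  then obtain w where "(u, w) \<in> adj_rel G" using \<open>u \<noteq> v\<close> by (auto elim: converse_rtranclE)
  then have "w \<in> nbrs G u" by (simp add: adj_rel_iff_nbrs)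
  then have "v \<in> nbrs G u" using nu by auto
  then have uv: "{u, v} \<in> edges G" by (simp add: nbrs_def insert_commute)
  have "x \<in> {u, v}" if "(u, x) \<in> (adj_rel G)\<^sup>*" for x
    using that
  proof induction
    case (step y z)
    then have "z \<in> nbrs G y" by (simp add: adj_rel_iff_nbrs)
    then show ?case using step.IH nu nv by auto
  qed auto
  then have "{u, v} = {w \<in> verts G. gdist G u w \<noteq> \<infinity>}"
    using assms(4,5) \<open>(u, v) \<in> (adj_rel G)\<^sup>*\<close> unfolding gdist_finite_iff by blast
  then have "{u, v} \<in> components G" unfolding components_def using assms(4) by blast
  with uv iso show False by (auto simp: isolated_edge_def)
qed

text \<open>The index is a \<open>LEAST\<close>, which says something only if some number of colours is admissible.\<close>

lemma adj_strong_colouring_exists: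
  assumes G: "simple_graph G" and iso: "\<nexists>e. isolated_edge G e"
  shows "\<exists>c. proper_edge_colouring G (adj_strong_chromatic_index r G) c \<and>
        (\<forall>u\<in>verts G. \<forall>v\<in>verts G.
           1 \<le> gdist G u v \<and> gdist G u v \<le> enat r \<longrightarrow> colour_set G c u \<noteq> colour_set G c v)"
  unfolding adj_strong_chromatic_index_def
proof (rule LeastI_ex)
  obtain f :: "_ \<Rightarrow> nat" where f: "bij_betw f (edges G) {1..card (edges G)}"
    using finite_same_card_bij[OF finite_edges[OF G], of "{1..card (edges G)}"] by auto
  then have inj: "inj_on f (edges G)" by (simp add: bij_betw_def)
  have "proper_edge_colouring G (card (edges G)) f"
    using f inj unfolding proper_edge_colouring_def bij_betw_def inj_on_def by blast
  moreover have "colour_set G f u \<noteq> colour_set G f v"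
    if "u \<in> verts G" "v \<in> verts G" "1 \<le> gdist G u v" "gdist G u v \<le> enat r" for u v
  proof (rule rainbow_distinguishes[OF G iso inj that(1,2)])
    show "u \<noteq> v" using that(3) by (auto simp: gdist_self)
    show "gdist G u v \<noteq> \<infinity>" using that(4) by (cases "gdist G u v") auto
  qed
  ultimately show "\<exists>k c. proper_edge_colouring G k c \<and>
        (\<forall>u\<in>verts G. \<forall>v\<in>verts G.
           1 \<le> gdist G u v \<and> gdist G u v \<le> enat r \<longrightarrow> colour_set G c u \<noteq> colour_set G c v)"
    by blast
qed

text \<open>A proper colouring uses \<open>q\<close> distinct colours at a vertex of degree \<open>q\<close>; hence the colour sets
  inject the close vertices of \<open>X\<close> into the \<open>q\<close>-subsets of the colours.\<close>

lemma card_le_choose: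
  assumes G: "simple_graph G" and iso: "\<nexists>e. isolated_edge G e"
    and X: "X \<subseteq> verts G" and deg: "\<And>x. x \<in> X \<Longrightarrow> degree G x = q"
    and close: "\<And>x y. x \<in> X \<Longrightarrow> y \<in> X \<Longrightarrow> gdist G x y \<le> enat r"
  shows "card X \<le> adj_strong_chromatic_index r G choose q"
proof -
  define k where "k = adj_strong_chromatic_index r G"
  obtain c where c: "proper_edge_colouring G k c"
    and dist: "\<And>u v. u \<in> verts G \<Longrightarrow> v \<in> verts G \<Longrightarrow> 1 \<le> gdist G u v \<Longrightarrow>
      gdist G u v \<le> enat r \<Longrightarrow> colour_set G c u \<noteq> colour_set G c v"
    using adj_strong_colouring_exists[OF G iso, of r] unfolding k_def by blast
  have "inj_on (colour_set G c) X"
    using dist[OF _ _ gdist_ge_1 close] X by (intro inj_onI) blast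
  moreover have "colour_set G c ` X \<subseteq> {B. B \<subseteq> {1..k} \<and> card B = q}"
  proof (intro image_subsetI CollectI conjI)
    fix x assume x: "x \<in> X"
    show "colour_set G c x \<subseteq> {1..k}"
      using c by (auto simp: colour_set_def proper_edge_colouring_def nbrs_def)
    have proper: "c e \<noteq> c f" if "e \<in> edges G" "f \<in> edges G" "e \<noteq> f" "e \<inter> f \<noteq> {}" for e f
      using c that by (simp add: proper_edge_colouring_def)
    have "inj_on (\<lambda>u. c {u, x}) (nbrs G x)"
    proof (rule inj_onI)
      fix u w assume *: "u \<in> nbrs G x" "w \<in> nbrs G x" "c {u, x} = c {w, x}"
      then have "{u, x} \<in> edges G" "{w, x} \<in> edges G" by (simp_all add: nbrs_def)
      moreover have "{u, x} \<inter> {w, x} \<noteq> {}" by auto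
      ultimately have "{u, x} = {w, x}"
        using *(3) proper by metis
      then show "u = w" by (auto simp: doubleton_eq_iff)
    qed
    then show "card (colour_set G c x) = q"
      using deg[OF x] by (simp add: colour_set_def card_image degree_def)
  qed
  ultimately have "card X \<le> card {B. B \<subseteq> {1..k} \<and> card B = q}"
    by (intro card_inj_on_le) auto
  also have "\<dots> = k choose q" by (subst n_subsets) auto
  finally show ?thesis by (simp add: k_def)
qed

section \<open>Graphs on the natural numbers from adjacency relations\<close>

definition graph_of :: "'a::countable set \<Rightarrow> ('a \<Rightarrow> 'a \<Rightarrow> bool) \<Rightarrow> nat ugraph" where
  "graph_of V E = \<lparr>verts = to_nat ` V, edges = {{to_nat u, to_nat v} | u v. u \<in> V \<and> v \<in> V \<and> E u v}\<rparr>"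

lemma simple_graph_of:
  assumes "finite V" "V \<noteq> {}" "\<And>u. \<not> E u u"
  shows "simple_graph (graph_of V E)"
  using assms unfolding simple_graph_def graph_of_def
  by (auto simp: card_2_iff) (metis from_nat_to_nat)

lemma edge_graph_of_iff:
  assumes "\<And>u v. E u v \<Longrightarrow> E v u"
  shows "{to_nat u, to_nat v} \<in> edges (graph_of V E) \<longleftrightarrow> u \<in> V \<and> v \<in> V \<and> E u v"
  using assms by (auto simp: graph_of_def doubleton_eq_iff)

lemma degree_graph_of:
  assumes "\<And>u v. E u v \<Longrightarrow> E v u" "v \<in> V"
  shows "degree (graph_of V E) (to_nat v) = card {u \<in> V. E v u}"
proof -
  have "nbrs (graph_of V E) (to_nat v) = to_nat ` {u \<in> V. E v u}"
    using assms unfolding nbrs_def graph_of_def by (auto simp: doubleton_eq_iff)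
  then show ?thesis by (simp add: degree_def card_image)
qed

text \<open>The reflexive closure lets a walk pause. Pauses occur because the shift of a word may be the word
  itself, and because a hub needs no step to reach its own word.\<close>

lemma gdist_graph_of_le:
  assumes sym: "\<And>u v. E u v \<Longrightarrow> E v u"
    and walk: "(u, v) \<in> ({(x, y). x \<in> V \<and> y \<in> V \<and> E x y}\<^sup>=) ^^ i"
  shows "gdist (graph_of V E) (to_nat u) (to_nat v) \<le> enat i"
proof (rule gdist_le)
  show "(to_nat u, to_nat v) \<in> ((adj_rel (graph_of V E))\<^sup>=) ^^ i"
    using walk
  proof (induction i arbitrary: v)
    case (Suc i)
    then obtain w where w: "(u, w) \<in> ({(x, y). x \<in> V \<and> y \<in> V \<and> E x y}\<^sup>=) ^^ i"
      "w = v \<or> (w \<in> V \<and> v \<in> V \<and> E w v)" by auto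
    then have "(to_nat w, to_nat v) \<in> (adj_rel (graph_of V E))\<^sup>="
      using edge_graph_of_iff[of E, OF sym] by (auto simp: adj_rel_def)
    then show ?case using Suc.IH[OF w(1)] by auto
  qed auto
qed

section \<open>De Bruijn graphs with pendant cliques\<close>

text \<open>A vertex \<open>(w, None)\<close> is the hub \<open>w\<close>, and \<open>(w, Some (a, b))\<close> is the \<open>b\<close>-th leaf of the \<open>a\<close>-th clique
  attached to that hub.\<close>

type_synonym db_vertex = "nat list \<times> (nat \<times> nat) option"

definition words :: "nat \<Rightarrow> nat \<Rightarrow> nat list set" where
  "words n m = {w. set w \<subseteq> {..<m} \<and> length w = n}"

definition db_verts :: "nat \<Rightarrow> nat \<Rightarrow> nat \<Rightarrow> nat \<Rightarrow> db_vertex set" where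
  "db_verts n m h q = words n m \<times> insert None (Some ` ({..<h} \<times> {..<q}))"

fun db_adj :: "db_vertex \<Rightarrow> db_vertex \<Rightarrow> bool" where
  "db_adj (u, None) (v, None) \<longleftrightarrow> u \<noteq> v \<and> (tl u = butlast v \<or> tl v = butlast u)"
| "db_adj (u, Some (a, b)) (v, Some (a', b')) \<longleftrightarrow> u = v \<and> a = a' \<and> b \<noteq> b'"
| "db_adj (u, _) (v, _) \<longleftrightarrow> u = v"

abbreviation db_graph :: "nat \<Rightarrow> nat \<Rightarrow> nat \<Rightarrow> nat \<Rightarrow> nat ugraph" where
  "db_graph n m h q \<equiv> graph_of (db_verts n m h q) db_adj"

lemma db_adj_sym: "db_adj x y \<Longrightarrow> db_adj y x"
  by (induction x y rule: db_adj.induct) auto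

lemma db_adj_irrefl: "\<not> db_adj x x"
  by (cases x; cases "snd x") auto

lemma finite_words: "finite (words n m)"
  unfolding words_def by (rule finite_lists_length_eq) simp

lemma card_words: "card (words n m) = m ^ n"
  unfolding words_def by (simp add: card_lists_length_eq)

lemma finite_db_verts: "finite (db_verts n m h q)"
  by (simp add: db_verts_def finite_words)

lemma db_simple: "m > 0 \<Longrightarrow> simple_graph (db_graph n m h q)"
proof (rule simple_graph_of)
  assume "m > 0"
  then have "replicate n 0 \<in> words n m" by (auto simp: words_def)
  then show "db_verts n m h q \<noteq> {}" by (auto simp: db_verts_def)
qed (auto simp: finite_db_verts db_adj_irrefl)

lemma db_leaf_degree:
  assumes "w \<in> words n m" "a < h" "b < q"
  shows "degree (db_graph n m h q) (to_nat (w, Some (a, b))) = q"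
proof -
  have "{x \<in> db_verts n m h q. db_adj (w, Some (a, b)) x}
      = insert (w, None) ((\<lambda>b'. (w, Some (a, b'))) ` ({..<q} - {b}))"
    using assms by (auto simp: db_verts_def)
  also have "card \<dots> = Suc (card ({..<q} - {b}))"
    by (subst card_insert_disjoint) (auto simp: card_image inj_on_def)
  also have "\<dots> = q" using assms by simp
  finally show ?thesis
    using assms by (subst degree_graph_of) (auto simp: db_verts_def dest: db_adj_sym)
qed

lemma db_hub_degree:
  assumes "w \<in> words n m" "n > 0"
  shows "h * q \<le> degree (db_graph n m h q) (to_nat ((w, None) :: db_vertex))"
    and "degree (db_graph n m h q) (to_nat ((w, None) :: db_vertex)) \<le> 2 * m + h * q"
proof -
  let ?N = "{x \<in> db_verts n m h q. db_adj (w, None) x}"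
  let ?L = "(\<lambda>p. (w, Some p)) ` ({..<h} \<times> {..<q})"
  let ?P = "(\<lambda>x. (x # butlast w, None) :: db_vertex) ` {..<m}"
  let ?S = "(\<lambda>x. (tl w @ [x], None) :: db_vertex) ` {..<m}"
  have L: "card ?L = h * q" by (simp add: card_image inj_on_def)
  have deg: "degree (db_graph n m h q) (to_nat ((w, None) :: db_vertex)) = card ?N"
    using assms by (subst degree_graph_of) (auto simp: db_verts_def dest: db_adj_sym)
  have fin: "finite ?N" by (simp add: finite_db_verts)
  have "?L \<subseteq> ?N" using assms by (auto simp: db_verts_def)
  then show "h * q \<le> degree (db_graph n m h q) (to_nat ((w, None) :: db_vertex))"
    unfolding deg L[symmetric] by (rule card_mono[OF fin])
  have "?N \<subseteq> ?L \<union> (?P \<union> ?S)"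
  proof
    fix y assume y: "y \<in> ?N"
    obtain u c where u: "y = (u, c)" by (cases y)
    show "y \<in> ?L \<union> (?P \<union> ?S)"
    proof (cases c)
      case None
      have uw: "set u \<subseteq> {..<m}" "u \<noteq> []"
        using y u None assms by (auto simp: db_verts_def words_def)
      have "tl w = butlast u \<or> tl u = butlast w" using y u None by auto
      then show ?thesis
      proof
        assume "tl w = butlast u"
        then have "u = tl w @ [last u]" using uw by simp
        moreover have "last u \<in> {..<m}" using uw last_in_set by blast
        ultimately show ?thesis using u None by blast
      next
        assume "tl u = butlast w"
        then have "u = hd u # butlast w" using uw by (metis list.collapse)
        moreover have "hd u \<in> {..<m}" using uw hd_in_set by blast
        ultimately show ?thesis using u None by blast
      qed
    next
      case (Some p)
      then show ?thesis using y u by (cases p) (auto simp: db_verts_def)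
    qed
  qed
  then have "card ?N \<le> card (?L \<union> (?P \<union> ?S))" by (intro card_mono) auto
  also have "\<dots> \<le> card ?L + (card ?P + card ?S)"
    using card_Un_le[of ?L "?P \<union> ?S"] card_Un_le[of ?P ?S] by linarith
  also have "\<dots> \<le> h * q + (m + m)"
    unfolding L by (intro add_mono order_refl order_trans[OF card_image_le]) auto
  finally show "degree (db_graph n m h q) (to_nat ((w, None) :: db_vertex)) \<le> 2 * m + h * q"
    unfolding deg by simp
qed

text \<open>Shifting in the letters of \<open>v\<close> one at a time turns \<open>u\<close> into \<open>v\<close> after \<open>n\<close> steps.\<close>

lemma db_hub_walk:
  assumes u: "u \<in> words n m" and v: "v \<in> words n m"
  shows "((u, None), (v, None)) \<in> ({(x, y). x \<in> db_verts n m h q \<and> y \<in> db_verts n m h q \<and> db_adj x y}\<^sup>=) ^^ n"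
    (is "_ \<in> (?R\<^sup>=) ^^ n")
proof -
  have "((u, None), (drop i u @ take i v, None)) \<in> (?R\<^sup>=) ^^ i" if "i \<le> n" for i
    using that
  proof (induction i)
    case (Suc i)
    have len: "length u = n" "length v = n" "i < n" using u v Suc.prems by (auto simp: words_def)
    let ?x = "drop i u @ take i v" and ?y = "drop (Suc i) u @ take (Suc i) v"
    have "?x \<in> words n m" "?y \<in> words n m"
      using u v len set_drop_subset set_take_subset by (force simp: words_def)+
    moreover have "tl ?x = butlast ?y"
      using len by (simp add: drop_Suc tl_drop take_Suc_conv_app_nth butlast_append)
    ultimately have "((?x, None), (?y, None)) \<in> ?R\<^sup>="
      by (auto simp: db_verts_def)
    then show ?case using Suc by auto
  qed auto
  from this[of n] show ?thesis using u v by (simp add: words_def)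
qed

lemma db_diameter:
  assumes "x \<in> verts (db_graph n m h q)" "y \<in> verts (db_graph n m h q)"
  shows "gdist (db_graph n m h q) x y \<le> enat (n + 2)"
proof -
  let ?R = "{(x, y). x \<in> db_verts n m h q \<and> y \<in> db_verts n m h q \<and> db_adj x y}"
  obtain u c v c' where u: "x = to_nat (u, c)" "(u, c) \<in> db_verts n m h q"
    and v: "y = to_nat (v, c')" "(v, c') \<in> db_verts n m h q"
    using assms by (auto simp: graph_of_def)
  have R: "((w, p), (w, None)) \<in> ?R\<^sup>=" "((w, None), (w, p)) \<in> ?R\<^sup>="
    if "(w, p) \<in> db_verts n m h q" for w p
    using that by (cases p; auto simp: db_verts_def)+
  have "((u, None), (v, None)) \<in> (?R\<^sup>=) ^^ n"
    using u v by (intro db_hub_walk) (auto simp: db_verts_def)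
  then have "((u, c), (v, None)) \<in> (?R\<^sup>=) ^^ Suc n"
    using R(1)[OF u(2)] by (rule relpow_Suc_I2[rotated])
  then have "((u, c), (v, c')) \<in> (?R\<^sup>=) ^^ Suc (Suc n)"
    using R(2)[OF v(2)] by (rule relpow_Suc_I)
  then have "gdist (db_graph n m h q) x y \<le> enat (Suc (Suc n))"
    unfolding u v by (intro gdist_graph_of_le[OF db_adj_sym])
  then show ?thesis by simp
qed

lemma db_graph_properties:
  assumes "n > 0" "m > 1" "h > 0" "q > 0"
  defines "G \<equiv> db_graph n m h q"
  shows "simple_graph G" "\<nexists>e. isolated_edge G e" "q \<le> min_degree G"
    "h * q \<le> max_degree G" "max_degree G \<le> 2 * m + h * q"
    "m ^ n * (h * q) \<le> adj_strong_chromatic_index (n + 2) G choose q"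
proof -
  let ?X = "to_nat ` (words n m \<times> Some ` ({..<h} \<times> {..<q}))"
  have V: "verts G = to_nat ` db_verts n m h q" by (simp add: G_def graph_of_def)
  have ne: "words n m \<noteq> {}" using card_words[of n m] assms by auto
  then obtain w where w: "w \<in> words n m" by auto
  show simple: "simple_graph G" unfolding G_def using assms by (intro db_simple) auto
  then have fin: "finite (verts G)" "verts G \<noteq> {}" by (auto simp: simple_graph_def)
  have XV: "?X \<subseteq> verts G" unfolding V db_verts_def by (intro image_mono) auto
  have cX: "card ?X = m ^ n * (h * q)"
    by (simp add: card_image card_cartesian_product card_words)
  have "card (verts G) = m ^ n * Suc (h * q)"
    unfolding V db_verts_def
    by (subst card_image, simp, subst card_cartesian_product, subst card_insert_disjoint)
       (auto simp: card_words card_image)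
  moreover have "m ^ n \<ge> m ^ 1" using assms by (intro power_increasing) auto
  then have "2 * 2 \<le> m ^ n * Suc (h * q)" using assms by (intro mult_mono) (auto simp: Suc_le_eq)
  ultimately have big: "card (verts G) > 2" by linarith
  have close: "gdist G x y \<le> enat (n + 2)" if "x \<in> verts G" "y \<in> verts G" for x y
    using that db_diameter unfolding G_def by blast
  have "gdist G x y \<noteq> \<infinity>" if "x \<in> verts G" "y \<in> verts G" for x y
    using close[OF that] by (cases "gdist G x y") auto
  then show iso: "\<nexists>e. isolated_edge G e"
    using no_isolated_edge[OF simple big] by blast
  have degs: "degree G x \<in> {q..2 * m + h * q}" if "x \<in> verts G" for x
  proof -
    obtain u c where u: "x = to_nat (u, c)" "(u, c) \<in> db_verts n m h q" using \<open>x \<in> verts G\<close> V by auto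
    have hq: "q \<le> h * q" using assms by simp
    show ?thesis
    proof (cases c)
      case None
      then have "u \<in> words n m" using u by (auto simp: db_verts_def)
      from db_hub_degree[OF this \<open>n > 0\<close>, of h q] show ?thesis
        using hq unfolding u(1) None G_def atLeastAtMost_iff by linarith
    next
      case (Some p)
      then have "degree G x = q" using u db_leaf_degree by (auto simp: G_def db_verts_def)
      then show ?thesis using hq unfolding atLeastAtMost_iff by linarith
    qed
  qed
  show "q \<le> min_degree G" "max_degree G \<le> 2 * m + h * q"
    using fin degs by (auto simp: min_degree_def max_degree_def)
  have "h * q \<le> degree G (to_nat ((w, None) :: db_vertex))"
    using db_hub_degree[OF w] assms by auto
  also have "\<dots> \<le> max_degree G"
    unfolding max_degree_def using fin w by (intro Max_ge imageI) (auto simp: V db_verts_def)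
  finally show "h * q \<le> max_degree G" .
  have deg: "degree G x = q" if x: "x \<in> ?X" for x
  proof -
    obtain u a b where "x = to_nat (u, Some (a, b))" "u \<in> words n m" "a < h" "b < q"
      using x by blast
    then show ?thesis by (simp add: G_def db_leaf_degree)
  qed
  show "m ^ n * (h * q) \<le> adj_strong_chromatic_index (n + 2) G choose q"
    unfolding cX[symmetric]
    by (rule card_le_choose[OF simple iso XV deg close[OF subsetD[OF XV] subsetD[OF XV]]])
qed

section \<open>Counting colour sets\<close>

text \<open>Both cases start from the same comparison. Its left side is \<open>q!\<close> times the number of leaves for
  the alphabet size \<open>n s\<close> and \<open>2 s / q\<close> cliques per hub, and its right side bounds the \<open>q\<close>-th power of
  the number of colours. The divisibility makes the number of cliques an integer.\<close>

lemma threshold_counting_bound: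
  fixes n q :: nat and \<beta> :: real
  assumes "n > 0" "q > 0"
    and bound: "\<forall>G. admissible_graph d G \<and> max_degree G \<ge> D \<longrightarrow>
            real (adj_strong_chromatic_index (n + 2) G) \<le> \<beta> * real (max_degree G)"
    and "d \<le> int q" and "s > 1" "D \<le> s" "q dvd s" "\<beta> \<ge> 0"
  shows "2 * real n ^ n * real s ^ (n + 1) * fact q \<le> (\<beta> * (2 * real s * (real n + 1))) ^ q"
proof -
  obtain t where s: "s = t * q" using \<open>q dvd s\<close> by (metis dvdE mult.commute)
  define G where "G = db_graph n (n * s) (2 * t) q"
  have "1 * s \<le> n * s" using \<open>n > 0\<close> by (intro mult_right_mono) auto
  then have m: "n * s > 1" using \<open>s > 1\<close> by linarith
  have t: "2 * t > 0" using \<open>s > 1\<close> s by (cases t) auto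
  note G = db_graph_properties[OF \<open>n > 0\<close> m t \<open>q > 0\<close>, folded G_def]
  define k where "k = adj_strong_chromatic_index (n + 2) G"
  have hq: "2 * t * q = 2 * s" by (simp add: s)
  have "admissible_graph d G" using G assms by (auto simp: admissible_graph_def)
  moreover have "max_degree G \<ge> D" using G(4) hq \<open>D \<le> s\<close> by linarith
  ultimately have "real k \<le> \<beta> * real (max_degree G)" using bound by (simp add: k_def)
  also have "\<dots> \<le> \<beta> * (2 * real s * (real n + 1))"
  proof -
    have "max_degree G \<le> 2 * s * (n + 1)" using G(5) hq by (simp add: algebra_simps)
    then have "real (max_degree G) \<le> real (2 * s * (n + 1))" by linarith
    then show ?thesis using \<open>\<beta> \<ge> 0\<close> by (intro mult_left_mono) (auto simp: algebra_simps)
  qed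
  finally have k: "real k \<le> \<beta> * (2 * real s * (real n + 1))" .
  have "(n * s) ^ n * (2 * s) * fact q \<le> (k choose q) * fact q"
    using G(6) unfolding hq k_def by (intro mult_right_mono) auto
  also have "\<dots> \<le> k ^ q" by (rule binomial_fact_pow)
  finally have "real ((n * s) ^ n * (2 * s) * fact q) \<le> real (k ^ q)" by (rule of_nat_mono)
  also have "real (k ^ q) \<le> (\<beta> * (2 * real s * (real n + 1))) ^ q"
    using k by (simp add: power_mono)
  finally show ?thesis by (simp add: power_mult_distrib algebra_simps)
qed

lemma fact_gt_3_times_two_power: "n \<ge> 5 \<Longrightarrow> 3 * 2 ^ n < (fact n :: real)"
proof (induction n rule: dec_induct)
  case (step n)
  have "3 * 2 ^ Suc n = 2 * (3 * 2 ^ n :: real)" by simp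
  also have "\<dots> < 2 * fact n" using step by simp
  also have "\<dots> \<le> real (Suc n) * fact n" using step by (intro mult_right_mono) auto
  finally show ?case by simp
qed (simp add: fact_numeral)

lemma two_power_times_Suc_power_less:
  assumes "n \<ge> 5"
  shows "2 ^ n * (real n + 1) ^ n < real n ^ n * fact n"
proof -
  have "(1 + 1 / real n) ^ n \<le> exp 1"
    using exp_ge_one_plus_x_over_n_power_n[of n 1] assms by simp
  also have "\<dots> \<le> 3" by (rule exp_le)
  finally have "(1 + 1 / real n) ^ n * real n ^ n \<le> 3 * real n ^ n" by (intro mult_right_mono) auto
  also have "(1 + 1 / real n) ^ n * real n ^ n = (real n + 1) ^ n"
    using assms by (simp add: power_mult_distrib[symmetric] field_simps)
  finally have "2 ^ n * (real n + 1) ^ n \<le> 2 ^ n * (3 * real n ^ n)" by (intro mult_left_mono) auto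
  also have "\<dots> = 3 * 2 ^ n * real n ^ n" by simp
  also have "\<dots> < fact n * real n ^ n"
    using fact_gt_3_times_two_power[OF assms] assms by (intro mult_strict_right_mono) auto
  finally show ?thesis by (simp add: mult.commute)
qed

text \<open>Here \<open>\<eta> = 1\<close> will do: after division by \<open>s ^ n\<close> the left side of the comparison still grows
  with \<open>s\<close>.\<close>

lemma threshold_gt:
  fixes d :: int
  assumes "n > 0"
    and asym: "\<And>\<eta>::real. \<eta> > 0 \<Longrightarrow> \<exists>D. \<forall>G. admissible_graph d G \<and> max_degree G \<ge> D \<longrightarrow>
            real (adj_strong_chromatic_index (n + 2) G) \<le> (1 + \<eta>) * real (max_degree G)"
  shows "int n < d"
proof (rule ccontr)
  assume "\<not> int n < d"
  then have d: "d \<le> int n" by simp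
  from asym[of 1] obtain D where D: "\<forall>G. admissible_graph d G \<and> max_degree G \<ge> D \<longrightarrow>
            real (adj_strong_chromatic_index (n + 2) G) \<le> 2 * real (max_degree G)" by auto
  \<comment> \<open>The comparison below reads \<open>2 n ^ n n! s ^ (n + 1) \<le> a s ^ n\<close>, which fails for \<open>s > a\<close>.\<close>
  define a where "a = (4 * (n + 1)) ^ n"
  define s where "s = n * (D + a + 2)"
  have "1 * (D + a + 2) \<le> s" unfolding s_def using \<open>n > 0\<close> by (intro mult_right_mono) auto
  then have s: "s > 1" "D \<le> s" "n dvd s" "a < s" by (auto simp: s_def)
  have "2 * real n ^ n * real s ^ (n + 1) * fact n \<le> (2 * (2 * real s * (real n + 1))) ^ n"
    using threshold_counting_bound[OF \<open>n > 0\<close> \<open>n > 0\<close> D d s(1-3)] by simp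
  also have "\<dots> = real a * real s ^ n" by (simp add: a_def power_mult_distrib[symmetric] algebra_simps)
  also have "\<dots> < real s * real s ^ n" using s by (intro mult_strict_right_mono) auto
  finally have "2 * real n ^ n * fact n * real s ^ (n + 1) < 1 * real s ^ (n + 1)"
    by (simp add: algebra_simps)
  then have "2 * real n ^ n * fact n < 1" using s by (simp only: mult_less_cancel_right) auto
  moreover have "2 * real n ^ n * fact n \<ge> 1 * 1 * 1"
    using \<open>n > 0\<close> by (intro mult_mono) (auto simp: fact_ge_1)
  ultimately show False by simp
qed

text \<open>Here the powers of \<open>s\<close> cancel, and the strict inequality between the constants leaves room for a
  small \<open>\<eta>\<close>.\<close>

lemma threshold_gt_Suc:
  fixes d :: int
  assumes "n \<ge> 5"
    and asym: "\<And>\<eta>::real. \<eta> > 0 \<Longrightarrow> \<exists>D. \<forall>G. admissible_graph d G \<and> max_degree G \<ge> D \<longrightarrow>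
            real (adj_strong_chromatic_index (n + 2) G) \<le> (1 + \<eta>) * real (max_degree G)"
  shows "int (n + 1) < d"
proof (rule ccontr)
  assume "\<not> int (n + 1) < d"
  then have d: "d \<le> int (n + 1)" by simp
  have "((\<lambda>\<eta>. (1 + \<eta>) ^ (n + 1) * (2 ^ n * (real n + 1) ^ n)) \<longlongrightarrow>
      (1 + 0) ^ (n + 1) * (2 ^ n * (real n + 1) ^ n)) (at_right 0)"
    by (intro tendsto_intros)
  then have "eventually (\<lambda>\<eta>. (1 + \<eta>) ^ (n + 1) * (2 ^ n * (real n + 1) ^ n) < real n ^ n * fact n) (at_right 0)"
    by (rule order_tendstoD) (use two_power_times_Suc_power_less[OF assms(1)] in simp)
  then obtain \<eta> where \<eta>: "\<eta> > 0" "(1 + \<eta>) ^ (n + 1) * (2 ^ n * (real n + 1) ^ n) < real n ^ n * fact n"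
    using eventually_happens[OF eventually_conj[OF _ eventually_at_right_less[of "0::real"]]]
    by force
  obtain D where D: "\<forall>G. admissible_graph d G \<and> max_degree G \<ge> D \<longrightarrow>
            real (adj_strong_chromatic_index (n + 2) G) \<le> (1 + \<eta>) * real (max_degree G)"
    using asym[OF \<eta>(1)] by auto
  define s where "s = (n + 1) * (D + 2)"
  have "1 * (D + 2) \<le> s" unfolding s_def by (intro mult_right_mono) auto
  then have s: "s > 1" "D \<le> s" by auto
  have "(n + 1) dvd s" unfolding s_def by (rule dvd_triv_left)
  have "2 * real n ^ n * real s ^ (n + 1) * fact (n + 1) \<le> ((1 + \<eta>) * (2 * real s * (real n + 1))) ^ (n + 1)"
    using \<eta> assms by (intro threshold_counting_bound[OF _ _ D d s \<open>(n + 1) dvd s\<close>]) auto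
  moreover have "fact (n + 1) = (real n + 1) * fact n" by (simp add: algebra_simps)
  ultimately have "(2 * (real n + 1) * real s ^ (n + 1)) * (real n ^ n * fact n) \<le>
      (2 * (real n + 1) * real s ^ (n + 1)) * ((1 + \<eta>) ^ (n + 1) * (2 ^ n * (real n + 1) ^ n))"
    by (simp only: power_mult_distrib power_add power_one_right mult_ac)
  moreover have "2 * (real n + 1) * real s ^ (n + 1) > 0" using s by simp
  ultimately show False using \<eta>(2) by (meson mult_le_cancel_left_pos not_le)
qed

theorem mainTheorem3:
  fixes r :: nat and \<delta>\<^sub>0 :: int
  assumes "r > 2"
    and "(\<exists>C::real. \<forall>G. admissible_graph \<delta>\<^sub>0 G \<longrightarrow>
            real (adj_strong_chromatic_index r G) \<le> real (max_degree G) + C)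
       \<or> (\<forall>\<eta>::real. \<eta> > 0 \<longrightarrow> (\<exists>\<Delta>\<^sub>0::nat. \<forall>G. admissible_graph \<delta>\<^sub>0 G \<and> max_degree G \<ge> \<Delta>\<^sub>0 \<longrightarrow>
            real (adj_strong_chromatic_index r G) \<le> (1 + \<eta>) * real (max_degree G)))"
  shows "(r \<ge> 7 \<longrightarrow> \<delta>\<^sub>0 \<ge> int r) \<and> (3 \<le> r \<and> r \<le> 6 \<longrightarrow> \<delta>\<^sub>0 \<ge> int r - 1)"
proof -
  obtain n where n: "r = n + 2" "n > 0" using assms(1) by (metis add.commute less_imp_add_positive)
  have asym: "\<exists>D. \<forall>G. admissible_graph \<delta>\<^sub>0 G \<and> max_degree G \<ge> D \<longrightarrow>
            real (adj_strong_chromatic_index (n + 2) G) \<le> (1 + \<eta>) * real (max_degree G)"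
    if "\<eta> > 0" for \<eta> :: real
    using assms(2)
  proof
    assume "\<exists>C::real. \<forall>G. admissible_graph \<delta>\<^sub>0 G \<longrightarrow>
            real (adj_strong_chromatic_index r G) \<le> real (max_degree G) + C"
    then obtain C :: real where C: "\<And>G. admissible_graph \<delta>\<^sub>0 G \<Longrightarrow>
            real (adj_strong_chromatic_index r G) \<le> real (max_degree G) + C" by blast
    obtain D :: nat where "C / \<eta> \<le> real D" using real_arch_simple by blast
    then have D: "C \<le> \<eta> * real D" using \<open>\<eta> > 0\<close> by (simp add: field_simps)
    have "real (adj_strong_chromatic_index (n + 2) G) \<le> (1 + \<eta>) * real (max_degree G)"
      if "admissible_graph \<delta>\<^sub>0 G" "max_degree G \<ge> D" for G
    proof -
      have "\<eta> * real D \<le> \<eta> * real (max_degree G)"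
        using that \<open>\<eta> > 0\<close> by (intro mult_left_mono) auto
      then show ?thesis using C[OF that(1)] D n(1) by (simp add: algebra_simps)
    qed
    then show ?thesis by blast
  qed (use that n in blast)
  have "int n < \<delta>\<^sub>0" using threshold_gt[OF n(2) asym] .
  moreover have "int (n + 1) < \<delta>\<^sub>0" if "n \<ge> 5" using threshold_gt_Suc[OF that asym] .
  ultimately show ?thesis using n by auto
qed

end
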